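(* Let $a,b$ be nonnegative integers, let $p>3$ be a prime, and let $k$ be an integer with $0\leq k\leq\frac{p-3}{2}$. Then $$M^{a,b}_{p-3-k}\equiv (b^2-4a^2)^{\frac{p-3}{2}-k}\,M^{a,b}_k\pmod p.$$ In particular, writing $M_n=M^{1,1}_n$, one has $M_{p-3-k}\equiv(-3)^{\frac{p-3}{2}-k}M_k\pmod p$.
   Context: For a Laurent polynomial $Q(x)$, $\mathrm{ct}[Q(x)]$ denotes its constant term (the coefficient of $x^0$). For nonnegative integers $a,b$ and $n\ge0$, the generalized Motzkin number is $M^{a,b}_n=\mathrm{ct}\left[(ax^{-1}+b+ax)^n(1-x^2)\right]$; equivalently, it counts lattice paths from $(0,0)$ to $(n,0)$ that do not go below the x-axis, with steps UP $=(1,1)$, LEVEL $=(1,0)$ and DOWN $=(1,-1)$, with $a$ colors for each UP step and for each DOWN step and $b$ colors for each LEVEL step. The convention $y^0=1$ for every integer $y$ (including $y=0$) is used. *)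

theory Defs
  imports "HOL-Computational_Algebra.Formal_Laurent_Series" "HOL-Number_Theory.Cong"
begin

text \<open>Laurent polynomials are taken inside the ring of formal Laurent series.\<close>

definition ct :: "'a::zero fls \<Rightarrow> 'a" where
  "ct Q = fls_nth Q 0"

definition motzkin :: "nat \<Rightarrow> nat \<Rightarrow> nat \<Rightarrow> int" where
  "motzkin a b n =
     ct ((of_nat a * fls_X_inv + of_nat b + of_nat a * fls_X) ^ n * (1 - fls_X\<^sup>2))"

end

theory Submission imports Defs begin

text \<open>
  With \<open>D = b\<^sup>2 - 4 a\<^sup>2\<close>, the numbers \<open>M n\<close> satisfy
  \<open>(n + 4) M (n + 2) = (2 n + 5) b M (n + 1) - (n + 1) D M n\<close>. Put \<open>p = 2 h + 3\<close>.
  Modulo \<open>p\<close> the reflection about \<open>h\<close> turns this recurrence into itself, up to powers of \<open>D\<close>,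
  so \<open>M (h + j) \<equiv> D ^ j M (h - j)\<close> follows by induction on \<open>j\<close>. Starting from the centre
  avoids any division by \<open>D\<close>, which may vanish modulo \<open>p\<close>; at \<open>j = 1\<close> the middle
  coefficient of the recurrence is exactly \<open>p\<close>.
\<close>

lemma ct_diff: "ct (f - g) = ct f - ct (g :: 'a::group_add fls)"
  by (simp add: ct_def)

lemma ct_add: "ct (f + g) = ct f + ct (g :: 'a::group_add fls)"
  by (simp add: ct_def)

lemma ct_of_int_mult: "ct (of_int c * f) = c * ct (f :: int fls)"
  by (simp add: ct_def fls_of_int)

text \<open>The operator \<open>x d/dx\<close> multiplies the coefficient of \<open>x^n\<close> by
  \<open>n\<close>.\<close>

lemma ct_fls_X_times_deriv: "ct (fls_X * fls_deriv f) = (0 :: 'a::ring_1)"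
  by (simp add: ct_def fls_X_times_conv_shift)

lemma fls_X_inv_times_X: "fls_X_inv * fls_X = (1 :: 'a::ring_1 fls)"
  by (simp add: fls_X_inv_times_conv_shift fls_X_conv_shift_1)

text \<open>
  The factor \<open>m + 2\<close> on the left cannot be dropped: without it, the recurrence operator differs
  from a derivative by a multiple of \<open>(1/x - x) P ^ (m + 1)\<close>, which has to be integrated
  to \<open>P ^ (m + 2)\<close>.
\<close>
lemma motzkin_certificate:
  fixes a b m :: nat
  defines "P \<equiv> of_nat a * fls_X_inv + of_nat b + of_nat a * (fls_X :: int fls)"
  defines "R \<equiv> of_nat a * (fls_X - fls_X_inv) * (1 - fls_X\<^sup>2)"
  shows "of_nat (m + 2) * ((of_nat (m + 4) * P\<^sup>2 - of_nat (2 * m + 5) * of_nat b * P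
            + of_nat (m + 1) * ((of_nat b)\<^sup>2 - 4 * (of_nat a)\<^sup>2)) * P ^ m * (1 - fls_X\<^sup>2))
         = fls_X * fls_deriv (of_nat (m + 2) * (R * P ^ (m + 1)) - of_nat 2 * P ^ (m + 2))"
proof -
  have XY: "fls_X_inv * fls_X = (1 :: int fls)" by (rule fls_X_inv_times_X)
  have dP: "fls_deriv P = of_nat a * (1 - fls_X_inv\<^sup>2)"
    by (simp add: P_def algebra_simps)
  have dR: "fls_deriv R = of_nat a * ((1 + fls_X_inv\<^sup>2) * (1 - fls_X\<^sup>2) - (fls_X - fls_X_inv) * (2 * fls_X))"
    by (simp add: R_def algebra_simps power2_eq_square)
  have pow: "fls_deriv (P ^ Suc n) = of_nat (Suc n) * fls_deriv P * P ^ n" for n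
    by (simp add: fls_deriv_power algebra_simps del: power_Suc)
  \<comment> \<open>With \<open>q\<close> standing for \<open>P ^ m\<close>, the goal reduces to an
    identity without symbolic powers.\<close>
  have regroup: "n * (A * q * w) = x * d" if "d = n * q * B" "A * w = x * B"
    for n A q w x d B :: "int fls"
    using that by algebra
  have "fls_deriv (of_nat (m + 2) * (R * P ^ (m + 1)) - of_nat 2 * P ^ (m + 2))
    = of_nat (m + 2) * P ^ m * (fls_deriv R * P + of_nat (m + 1) * R * fls_deriv P - 2 * fls_deriv P * P)"
    using pow[of m] pow[of "Suc m"] by (simp add: algebra_simps del: power_Suc) (simp add: algebra_simps)
  \<comment> \<open>A polynomial identity in \<open>x\<close> and \<open>1/x\<close>, which holds
    modulo the relation \<open>XY\<close>.\<close>
  moreover have "(of_nat (m + 4) * P\<^sup>2 - of_nat (2 * m + 5) * of_nat b * P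
            + of_nat (m + 1) * ((of_nat b)\<^sup>2 - 4 * (of_nat a)\<^sup>2)) * (1 - fls_X\<^sup>2)
      = fls_X * (fls_deriv R * P + of_nat (m + 1) * R * fls_deriv P - 2 * fls_deriv P * P)"
    unfolding dP dR unfolding P_def R_def of_nat_add of_nat_mult of_nat_numeral of_nat_1
    using XY by algebra
  ultimately show ?thesis by (rule regroup)
qed

text \<open>Constant terms of the certificate: its right side contributes 0, and the factor
  \<open>m + 2\<close> cancels over the integers.\<close>

lemma motzkin_recurrence:
  "int (m + 4) * motzkin a b (m + 2) = int (2 * m + 5) * int b * motzkin a b (m + 1)
     - int (m + 1) * ((int b)\<^sup>2 - 4 * (int a)\<^sup>2) * motzkin a b m"
proof -
  let ?P = "of_nat a * fls_X_inv + of_nat b + of_nat a * (fls_X :: int fls)"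
  let ?w = "1 - fls_X\<^sup>2 :: int fls"
  have "of_nat (m + 2) * ((of_nat (m + 4) * ?P\<^sup>2 - of_nat (2 * m + 5) * of_nat b * ?P
            + of_nat (m + 1) * ((of_nat b)\<^sup>2 - 4 * (of_nat a)\<^sup>2)) * ?P ^ m * ?w)
      = of_int (int (m + 2)) * (of_int (int (m + 4)) * (?P ^ (m + 2) * ?w)
          - of_int (int (2 * m + 5) * int b) * (?P ^ (m + 1) * ?w)
          + of_int (int (m + 1) * ((int b)\<^sup>2 - 4 * (int a)\<^sup>2)) * (?P ^ m * ?w))"
    by (simp add: power_add power2_eq_square) algebra
  then have "ct (of_int (int (m + 2)) * (of_int (int (m + 4)) * (?P ^ (m + 2) * ?w)
          - of_int (int (2 * m + 5) * int b) * (?P ^ (m + 1) * ?w)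
          + of_int (int (m + 1) * ((int b)\<^sup>2 - 4 * (int a)\<^sup>2)) * (?P ^ m * ?w))) = 0"
    using motzkin_certificate[of m a b] by (metis ct_fls_X_times_deriv)
  then have "int (m + 2) * (int (m + 4) * motzkin a b (m + 2) - int (2 * m + 5) * int b * motzkin a b (m + 1)
     + int (m + 1) * ((int b)\<^sup>2 - 4 * (int a)\<^sup>2) * motzkin a b m) = 0"
    unfolding ct_of_int_mult ct_diff ct_add motzkin_def .
  then show ?thesis
    by (simp only: mult_eq_0_iff of_nat_eq_0_iff) simp
qed

lemma motzkin_reflection:
  fixes a b p h j :: nat
  assumes p: "prime p" "p = 2 * h + 3" and "j \<le> h"
  shows "[motzkin a b (h + j) = ((int b)\<^sup>2 - 4 * (int a)\<^sup>2) ^ j * motzkin a b (h - j)] (mod int p)"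
  using \<open>j \<le> h\<close>
proof (induction j rule: less_induct)
  case (less j)
  define D where "D = (int b)\<^sup>2 - 4 * (int a)\<^sup>2"
  let ?M = "motzkin a b"
  \<comment> \<open>\<open>h + j + 2\<close> is the leading coefficient of the recurrence for
    \<open>?M (h + j)\<close>. It is a unit modulo \<open>p\<close>, since \<open>j \<le> h\<close>
    gives \<open>h + j + 2 < p\<close>.\<close>
  have cancel: "[x = y] (mod int p)"
    if "int p dvd int (h + j + 2) * (x - y)" for x y
  proof -
    have "\<not> p dvd h + j + 2" using less.prems p(2) by (intro nat_dvd_not_less) auto
    then have "\<not> int p dvd int (h + j + 2)" by (metis of_nat_dvd_iff)
    with that p(1) show ?thesis
      by (metis cong_iff_dvd_diff prime_dvd_mult_iff prime_nat_int_transfer)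
  qed
  consider "j = 0" | "j = 1" | i where "j = i + 2"
    by (metis One_nat_def add_2_eq_Suc' not0_implies_Suc)
  then show ?case
  proof cases
    case 1
    then show ?thesis by simp
  next
    case 2
    with less.prems obtain m where m: "h = m + 1" by (metis add.commute le_Suc_ex)
    \<comment> \<open>Here \<open>2 * m + 5 = p\<close> and
      \<open>(m + 1) + (m + 4) = p\<close>.\<close>
    have "int (m + 4) * (?M (m + 2) - D * ?M m)
        = int p * (int b * ?M (m + 1) - D * ?M m)"
      using motzkin_recurrence[of m a b] by (simp add: D_def[symmetric] p(2) m algebra_simps)
    then have "int p dvd int (m + 4) * (?M (m + 2) - D * ?M m)" by simp
    then show ?thesis using cancel 2 m by (simp add: D_def algebra_simps)
  next
    case 3
    with less.prems obtain m where m: "h = m + i + 2" by (metis add.assoc add.commute le_Suc_ex)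
    \<comment> \<open>The recurrences at \<open>s\<close> and \<open>m\<close> are mirror images:
      \<open>s + m + 5 = p\<close>, so modulo \<open>p\<close> the coefficients
      \<open>s + 4\<close>, \<open>2 * s + 5\<close>, \<open>s + 1\<close> become
      \<open>-(m + 1)\<close>, \<open>-(2 * m + 5)\<close>, \<open>-(m + 4)\<close>.\<close>
    define s where "s = m + 2 * i + 2"
    have idx: "h + (i + 1) = s + 1" "h - (i + 1) = m + 1" "h + i = s" "h - i = m + 2"
      "h + j = s + 2" "h - j = m" "j = i + 2" "h + j + 2 = s + 4"
      using 3 m by (simp_all add: s_def)
    have "[?M (s + 1) = D ^ (i + 1) * ?M (m + 1)] (mod int p)"
      using less.IH[of "i + 1"] less.prems idx by (simp add: D_def)
    then obtain u where u: "?M (s + 1) = D ^ (i + 1) * ?M (m + 1) + int p * u"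
      by (metis cong_iff_lin cong_sym)
    have "[?M s = D ^ i * ?M (m + 2)] (mod int p)"
      using less.IH[of i] less.prems idx by (simp add: D_def)
    then obtain v where v: "?M s = D ^ i * ?M (m + 2) + int p * v"
      by (metis cong_iff_lin cong_sym)
    have P: "int p = 2 * int m + 2 * int i + 7" using p(2) m by simp
    have r1: "(int s + 4) * ?M (s + 2) = (2 * int s + 5) * int b * ?M (s + 1) - (int s + 1) * D * ?M s"
      using motzkin_recurrence[of s a b] by (simp add: D_def)
    have r2: "(int m + 4) * ?M (m + 2) = (2 * int m + 5) * int b * ?M (m + 1) - (int m + 1) * D * ?M m"
      using motzkin_recurrence[of m a b] by (simp add: D_def)
    have S: "int s = int m + 2 * int i + 2" by (simp add: s_def)
    have "(int s + 4) * (?M (s + 2) - D ^ (i + 2) * ?M m)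
        = (2 * int s + 5) * int b * ?M (s + 1) - (int s + 1) * D * ?M s - (int s + 4) * D ^ (i + 2) * ?M m"
      by (simp only: right_diff_distrib r1 mult.assoc)
    \<comment> \<open>Apart from multiples of \<open>p\<close>, what remains is
      \<open>D ^ (i + 1)\<close> times the recurrence at \<open>m\<close>, which vanishes by
      \<open>r2\<close>.\<close>
    also have "\<dots> = int p * ((2 * int s + 5) * int b * u - (int s + 1) * D * v
          + 2 * D ^ (i + 1) * int b * ?M (m + 1) - D ^ (i + 1) * ?M (m + 2) - D ^ (i + 2) * ?M m)
        + D ^ (i + 1) * ((int m + 4) * ?M (m + 2)
          - ((2 * int m + 5) * int b * ?M (m + 1) - (int m + 1) * D * ?M m))"
      unfolding u v S P by (simp add: algebra_simps)
    finally have "int p dvd (int s + 4) * (?M (s + 2) - D ^ (i + 2) * ?M m)"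
      unfolding r2 by simp
    then have "int p dvd int (h + j + 2) * (?M (s + 2) - D ^ (i + 2) * ?M m)"
      unfolding idx(8) by simp
    from cancel[OF this] show ?thesis unfolding idx(5,6) unfolding D_def idx(7) .
  qed
qed

theorem theorem5:
  fixes a b p k :: nat
  assumes "prime p" and "p > 3" and "k \<le> (p - 3) div 2"
  shows "[motzkin a b (p - 3 - k) =
            ((int b)\<^sup>2 - 4 * (int a)\<^sup>2) ^ ((p - 3) div 2 - k) * motzkin a b k] (mod int p) \<and>
         [motzkin 1 1 (p - 3 - k) = (- 3) ^ ((p - 3) div 2 - k) * motzkin 1 1 k] (mod int p)"
proof -
  define h where "h = (p - 3) div 2"
  have "odd p" using assms(1,2) prime_odd_nat by simp
  with assms(2) have p: "p = 2 * h + 3" unfolding h_def by presburger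
  have k: "k \<le> h" using assms(3) by (simp add: h_def)
  \<comment> \<open>The reflection is applied at distance \<open>j = h - k\<close> from the
    centre.\<close>
  have idx: "h + (h - k) = p - 3 - k" "h - (h - k) = k" using p k by simp_all
  have gen: "[motzkin a b (p - 3 - k) =
      ((int b)\<^sup>2 - 4 * (int a)\<^sup>2) ^ (h - k) * motzkin a b k] (mod int p)" for a b
    using motzkin_reflection[OF assms(1) p, of "h - k" a b] unfolding idx by simp
  show ?thesis using gen[of a b] gen[of 1 1] by (simp add: h_def)
qed

end
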